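(* There are infinitely many pairwise nonisomorphic finite groups $G$ such that exactly one element of $G$ is not a commutator in $G$.
   Context: An element $x$ of a group $G$ is a commutator (in $G$) if $x = a^{-1}b^{-1}ab$ for some $a, b \in G$; an element of $G$ that is not of this form is a noncommutator of $G$. *)

theory Defs
  imports "HOL-Algebra.Group"
begin

definition is_commutator :: "('a, 'b) monoid_scheme \<Rightarrow> 'a \<Rightarrow> bool" where
  "is_commutator G x \<longleftrightarrow> (\<exists>a\<in>carrier G. \<exists>b\<in>carrier G.
     x = inv\<^bsub>G\<^esub> a \<otimes>\<^bsub>G\<^esub> inv\<^bsub>G\<^esub> b \<otimes>\<^bsub>G\<^esub> a \<otimes>\<^bsub>G\<^esub> b)"

definition noncommutators :: "('a, 'b) monoid_scheme \<Rightarrow> 'a set" where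
  "noncommutators G = {x \<in> carrier G. \<not> is_commutator G x}"

end

(*
  If G has a unique noncommutator z, then z is central of order two, and the central product
  (G x G)/<(z,z)> again has a unique noncommutator: an element is a noncommutator exactly when all
  its preimages in G x G have a noncommutator component, which leaves only the image
  of (z,1) and (1,z).  Iterating gives infinitely many orders as soon as one group of order
  greater than 2 is known.

  Such a group is (V1 + V2) : A6.  Here V1, V2 are the spaces of even subsets of a six-element set
  under symmetric difference; A6 acts on the first six points naturally and on the second six
  through the outer automorphism.  The noncommutator is the pair of full sets.
  It is not a commutator because any two commuting elements of A6 preserve, on one of the two
  sixes, an odd set up to complement; the parity of the intersection with that set vanishes on
  every commutator above the identity, but not on the full set.  (On one six alone the
  four-group <(12)(34),(12)(56)> has no such odd set; the outer automorphism exchanges it with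
  the four-group that fixes two points.)
*)

theory Submission
  imports Defs "HOL-Algebra.Weak_Morphisms"
begin

section \<open>Commutators and central products\<close>

text \<open>An inverse-free form: direct products and the explicit semidirect product below can then
  be treated without computing inverses.\<close>

lemma is_commutator_iff:
  fixes G (structure)
  assumes "group G" "x \<in> carrier G"
  shows "is_commutator G x \<longleftrightarrow> (\<exists>a\<in>carrier G. \<exists>b\<in>carrier G. b \<otimes>\<^bsub>G\<^esub> (a \<otimes>\<^bsub>G\<^esub> x) = a \<otimes>\<^bsub>G\<^esub> b)"
proof -
  interpret group G by fact
  have cancel: "p \<otimes> (inv p \<otimes> q) = q" "inv p \<otimes> (p \<otimes> q) = q"
    if "p \<in> carrier G" "q \<in> carrier G" for p q
    using that by (simp_all flip: m_assoc)
  have "x = inv a \<otimes> inv b \<otimes> a \<otimes> b \<longleftrightarrow> b \<otimes> (a \<otimes> x) = a \<otimes> b"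
    if ab: "a \<in> carrier G" "b \<in> carrier G" for a b
  proof
    assume "b \<otimes> (a \<otimes> x) = a \<otimes> b"
    then have "inv a \<otimes> (inv b \<otimes> (b \<otimes> (a \<otimes> x))) = inv a \<otimes> (inv b \<otimes> (a \<otimes> b))"
      by simp
    then show "x = inv a \<otimes> inv b \<otimes> a \<otimes> b"
      using ab assms(2) by (simp add: cancel m_assoc)
  qed (use ab in \<open>simp add: cancel m_assoc\<close>)
  then show ?thesis
    unfolding is_commutator_def by blast
qed

lemma (in group_hom) hom_is_commutator:
  "is_commutator G x \<Longrightarrow> is_commutator H (h x)"
  unfolding is_commutator_def by (auto intro!: bexI)

text \<open>Preimages of the two entries of a commutator in \<open>H\<close> give a commutator in
  \<open>G\<close> above it. Hence a noncommutator of the image is one whose whole fibre consists of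
  noncommutators.\<close>

lemma (in group_hom) noncommutators_surj:
  assumes "h ` carrier G = carrier H" "y \<in> carrier H"
  shows "y \<in> noncommutators H \<longleftrightarrow> (\<forall>x\<in>carrier G. h x = y \<longrightarrow> x \<in> noncommutators G)"
proof -
  have "\<exists>x\<in>carrier G. h x = y \<and> is_commutator G x" if comm: "is_commutator H y"
  proof -
    obtain c d where cd: "c \<in> carrier H" "d \<in> carrier H"
      "y = inv\<^bsub>H\<^esub> c \<otimes>\<^bsub>H\<^esub> inv\<^bsub>H\<^esub> d \<otimes>\<^bsub>H\<^esub> c \<otimes>\<^bsub>H\<^esub> d"
      using comm unfolding is_commutator_def by blast
    obtain a b where ab: "a \<in> carrier G" "b \<in> carrier G" "c = h a" "d = h b"
      using cd(1,2) unfolding assms(1)[symmetric] by blast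
    let ?x = "inv a \<otimes> inv b \<otimes> a \<otimes> b"
    have "?x \<in> carrier G" "h ?x = y" "is_commutator G ?x"
      using ab cd(3) by (auto simp: is_commutator_def)
    then show ?thesis by blast
  qed
  then show ?thesis
    using hom_is_commutator assms(2) unfolding noncommutators_def by blast
qed

lemma (in group) one_is_commutator: "is_commutator G \<one>"
  unfolding is_commutator_def by (intro bexI[of _ \<one>]) simp_all

lemma (in group) is_commutator_inv:
  assumes "is_commutator G x"
  shows "is_commutator G (inv x)"
proof -
  obtain a b where ab: "a \<in> carrier G" "b \<in> carrier G" "x = inv a \<otimes> inv b \<otimes> a \<otimes> b"
    using assms unfolding is_commutator_def by blast
  then have "inv x = inv b \<otimes> inv a \<otimes> b \<otimes> a"
    by (simp add: inv_mult_group m_assoc)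
  then show ?thesis
    using ab unfolding is_commutator_def by blast
qed

lemma (in group) is_commutator_conj:
  assumes "is_commutator G x" "x \<in> carrier G" "g \<in> carrier G"
  shows "is_commutator G (inv g \<otimes> x \<otimes> g)"
proof -
  have "(\<lambda>x. inv g \<otimes> x \<otimes> g) \<in> hom G G"
    using assms(3) inv_solve_right' by (auto simp: hom_def m_assoc) (simp_all flip: m_assoc)
  then interpret group_hom G G "\<lambda>x. inv g \<otimes> x \<otimes> g"
    by unfold_locales
  show ?thesis by (rule hom_is_commutator) fact
qed

text \<open>Inverses and conjugates of commutators are commutators, so the only noncommutator equals
  its own inverse and all its conjugates.\<close>

lemma (in group) unique_noncommutator:
  assumes "noncommutators G = {z}"
  shows "z \<in> carrier G" "z \<noteq> \<one>" "z \<otimes> z = \<one>" "\<And>g. g \<in> carrier G \<Longrightarrow> z \<otimes> g = g \<otimes> z"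
proof -
  have iff: "\<not> is_commutator G x \<longleftrightarrow> x = z" if "x \<in> carrier G" for x
    using assms that unfolding noncommutators_def by blast
  show z: "z \<in> carrier G" using assms unfolding noncommutators_def by blast
  show "z \<noteq> \<one>" using iff[OF z] one_is_commutator by blast
  have "inv z = z"
    using iff[OF z] iff[of "inv z"] is_commutator_inv[of "inv z"] z by auto
  then show "z \<otimes> z = \<one>"
    using r_inv[OF z] by simp
  show "z \<otimes> g = g \<otimes> z" if g: "g \<in> carrier G" for g
  proof -
    let ?y = "g \<otimes> z \<otimes> inv g"
    have "inv g \<otimes> ?y \<otimes> g = z"
      using g z by (simp add: m_assoc) (simp flip: m_assoc)
    then have "\<not> is_commutator G ?y"
      using is_commutator_conj[of ?y g] iff[OF z] g z by auto
    then have "?y = z"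
      using iff[of ?y] g z by simp
    then show ?thesis
      using g z by (metis inv_solve_right m_closed)
  qed
qed

section \<open>Central squares and the infinite family\<close>

definition one_noncommutator :: "('a, 'b) monoid_scheme \<Rightarrow> bool" where
  "one_noncommutator G \<longleftrightarrow> group G \<and> finite (carrier G) \<and> (\<exists>!x. x \<in> noncommutators G) \<and> 2 < order G"

lemma one_noncommutator_image:
  assumes "one_noncommutator G" "inj_on f (carrier G)"
  shows "one_noncommutator (image_group f G)" "order (image_group f G) = order G"
proof -
  interpret G: group G using assms(1) by (simp add: one_noncommutator_def)
  interpret group_hom G "image_group f G" f
    using G.inj_imp_image_group_is_group[OF assms(2)] inj_imp_image_group_iso[OF assms(2)]
    by (simp add: group_hom_def group_hom_axioms_def iso_def)
  show ord: "order (image_group f G) = order G"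
    by (simp add: order_def image_group_carrier card_image assms(2))
  obtain z where z: "z \<in> noncommutators G" "\<And>x. x \<in> noncommutators G \<Longrightarrow> x = z"
    using assms(1) unfolding one_noncommutator_def by blast
  have surj: "f ` carrier G = carrier (image_group f G)"
    by (simp add: image_group_carrier)
  have "z \<in> carrier G"
    using z(1) by (simp add: noncommutators_def)
  then have "f z \<in> noncommutators (image_group f G)"
    unfolding noncommutators_surj[OF surj hom_closed[OF \<open>z \<in> carrier G\<close>]]
    using z(1) inj_on_eq_iff[OF assms(2)] by blast
  moreover have "y = f z" if y: "y \<in> noncommutators (image_group f G)" for y
  proof -
    have "y \<in> carrier (image_group f G)"
      using y by (simp add: noncommutators_def)
    moreover from this obtain x where x: "x \<in> carrier G" "y = f x"
      unfolding surj[symmetric] by blast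
    ultimately have "x \<in> noncommutators G"
      using noncommutators_surj[OF surj] y by blast
    then show ?thesis using z x by blast
  qed
  ultimately show "one_noncommutator (image_group f G)"
    using assms(1) ord H.group_axioms unfolding one_noncommutator_def by (auto simp: image_group_carrier)
qed

text \<open>Central products change the element type; transport to \<open>nat\<close> brings all
  groups of the family into one type.\<close>

lemma one_noncommutator_nat:
  assumes "one_noncommutator G"
  obtains G' :: "nat monoid" where "one_noncommutator G'" "order G' = order G"
proof -
  obtain f :: "'a \<Rightarrow> nat" where "inj_on f (carrier G)"
    using finite_imp_inj_to_nat_seg[of "carrier G"] assms unfolding one_noncommutator_def by metis
  then show thesis
    using one_noncommutator_image[OF assms] that by blast
qed

lemma one_noncommutator_central_product:
  assumes "one_noncommutator G"
  shows "\<exists>N. one_noncommutator ((G \<times>\<times> G) Mod N) \<and> order G < order ((G \<times>\<times> G) Mod N)"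
proof -
  interpret G: group G using assms by (simp add: one_noncommutator_def)
  interpret P: group "G \<times>\<times> G" by (rule DirProd_group) (rule G.group_axioms)+
  let ?P = "G \<times>\<times> G"
  obtain z where nc: "noncommutators G = {z}"
    using assms unfolding one_noncommutator_def by blast
  note z = G.unique_noncommutator[OF nc]
  define N where "N = {(\<one>\<^bsub>G\<^esub>, \<one>\<^bsub>G\<^esub>), (z, z)}"
  have invz: "inv\<^bsub>G\<^esub> z = z"
    using z(1,3) G.inv_equality by blast
  have sub: "subgroup N ?P"
    using z(1,3) invz by (intro subgroup.intro) (auto simp: N_def inv_DirProd G.group_axioms)
  have "N \<lhd> ?P"
    unfolding P.normal_inv_iff
  proof (intro conjI ballI)
    fix x h assume x: "x \<in> carrier ?P" and h: "h \<in> N"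
    obtain p q where pq: "x = (p, q)" "p \<in> carrier G" "q \<in> carrier G"
      using x by auto
    show "x \<otimes>\<^bsub>?P\<^esub> h \<otimes>\<^bsub>?P\<^esub> inv\<^bsub>?P\<^esub> x \<in> N"
      using h pq z(1) z(4)[symmetric] by (auto simp: N_def inv_DirProd G.group_axioms G.m_assoc)
  qed (rule sub)
  then interpret N: normal N ?P .
  let ?Q = "?P Mod N"
  let ?h = "\<lambda>x. N #>\<^bsub>?P\<^esub> x"
  interpret group_hom ?P ?Q ?h
    using N.factorgroup_is_group N.r_coset_hom_Mod P.group_axioms
    by (simp add: group_hom_def group_hom_axioms_def)
  have surj: "?h ` carrier ?P = carrier ?Q"
    by (simp only: carrier_FactGroup)
  \<comment> \<open>Every coset of \<open>N\<close> is a pair of elements differing by the factor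
    \<open>(z, z)\<close>.\<close>
  have fibre: "?h x = ?h (g, k) \<longleftrightarrow> x = (g, k) \<or> x = (z \<otimes>\<^bsub>G\<^esub> g, z \<otimes>\<^bsub>G\<^esub> k)"
    if gk: "g \<in> carrier G" "k \<in> carrier G" "x \<in> carrier ?P" for g k x
  proof -
    have "?h x = ?h (g, k) \<longleftrightarrow> x \<in> N #>\<^bsub>?P\<^esub> (g, k)"
      using P.repr_independence[OF _ _ sub] P.rcos_self[OF _ sub] gk by (metis SigmaI carrier_DirProd)
    also have "\<dots> \<longleftrightarrow> x = (g, k) \<or> x = (z \<otimes>\<^bsub>G\<^esub> g, z \<otimes>\<^bsub>G\<^esub> k)"
      using gk by (auto simp: r_coset_def N_def)
    finally show ?thesis .
  qed
  have prod: "(g, k) \<in> noncommutators ?P \<longleftrightarrow> g = z \<or> k = z"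
    if gk: "g \<in> carrier G" "k \<in> carrier G" for g k
  proof -
    have "is_commutator ?P (g, k) \<longleftrightarrow> is_commutator G g \<and> is_commutator G k"
      using gk by (simp add: is_commutator_iff P.group_axioms G.group_axioms)
    moreover have "\<not> is_commutator G x \<longleftrightarrow> x = z" if "x \<in> carrier G" for x
      using nc that unfolding noncommutators_def by blast
    ultimately show ?thesis
      using gk unfolding noncommutators_def by auto
  qed
  have Q: "?h (g, k) \<in> noncommutators ?Q \<longleftrightarrow> (g, k) = (z, \<one>\<^bsub>G\<^esub>) \<or> (g, k) = (\<one>\<^bsub>G\<^esub>, z)"
    if gk: "g \<in> carrier G" "k \<in> carrier G" for g k
  proof -
    have zx: "z \<otimes>\<^bsub>G\<^esub> x = z \<longleftrightarrow> x = \<one>\<^bsub>G\<^esub>" if "x \<in> carrier G" for x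
      using that z(1) by simp
    have "?h (g, k) \<in> noncommutators ?Q \<longleftrightarrow>
        (g, k) \<in> noncommutators ?P \<and> (z \<otimes>\<^bsub>G\<^esub> g, z \<otimes>\<^bsub>G\<^esub> k) \<in> noncommutators ?P"
      using noncommutators_surj[OF surj, of "?h (g, k)"] fibre[OF gk] gk z(1) surj by auto
    \<comment> \<open>One component must be \<open>z\<close>, and, from the second preimage, one
      must be the identity; since \<open>z\<close> is not the identity, these are different
      components.\<close>
    also have "\<dots> \<longleftrightarrow> (g, k) = (z, \<one>\<^bsub>G\<^esub>) \<or> (g, k) = (\<one>\<^bsub>G\<^esub>, z)"
      using prod gk z(1,2) zx by auto
    finally show ?thesis .
  qed
  have "?h (\<one>\<^bsub>G\<^esub>, z) = ?h (z, \<one>\<^bsub>G\<^esub>)"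
    using fibre[of z "\<one>\<^bsub>G\<^esub>" "(\<one>\<^bsub>G\<^esub>, z)"] z(1,3) by simp
  then have "\<exists>!y. y \<in> noncommutators ?Q"
  proof (intro ex1I[of _ "?h (z, \<one>\<^bsub>G\<^esub>)"])
    show "?h (z, \<one>\<^bsub>G\<^esub>) \<in> noncommutators ?Q" using Q z(1) by blast
    fix y assume y: "y \<in> noncommutators ?Q"
    then have "y \<in> ?h ` carrier ?P"
      unfolding surj noncommutators_def by blast
    then obtain g k where "g \<in> carrier G" "k \<in> carrier G" "y = ?h (g, k)"
      by auto
    then show "y = ?h (z, \<one>\<^bsub>G\<^esub>)"
      using Q y \<open>?h (\<one>\<^bsub>G\<^esub>, z) = ?h (z, \<one>\<^bsub>G\<^esub>)\<close> by auto
  qed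
  moreover have "finite (carrier ?Q)"
    using assms surj finite_imageI[of "carrier ?P" ?h] by (simp add: one_noncommutator_def)
  moreover have "order G < order ?Q"
  proof -
    have "card N = 2" using z(2) by (simp add: N_def)
    then have "order ?Q * 2 = order G * order G"
      using P.lagrange[OF sub] by (simp add: order_def FactGroup_def card_cartesian_product)
    \<comment> \<open>The bound \<open>2 < order G\<close> makes the order grow; it excludes the
      group of order 2, whose central square has order 2 again.\<close>
    moreover have "order G * 2 < order G * order G"
      using assms by (simp add: one_noncommutator_def)
    ultimately show ?thesis by linarith
  qed
  ultimately show ?thesis
    using assms H.group_axioms unfolding one_noncommutator_def by (intro exI[of _ N]) auto
qed

text \<open>The set of orders that occur is nonempty and has no maximum, so it is infinite. One
  group is chosen for each order, and different orders exclude isomorphism.\<close>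

lemma infinite_family:
  fixes G :: "('a, 'b) monoid_scheme"
  assumes "one_noncommutator G"
  shows "\<exists>\<G> :: nat monoid set. infinite \<G> \<and>
           (\<forall>G\<in>\<G>. group G \<and> finite (carrier G) \<and> (\<exists>!x. x \<in> noncommutators G)) \<and>
           (\<forall>G\<in>\<G>. \<forall>H\<in>\<G>. G \<noteq> H \<longrightarrow> \<not> G \<cong> H)"
proof -
  define S where "S = {order G |G :: nat monoid. one_noncommutator G}"
  have "\<exists>m\<in>S. n < m" if n: "n \<in> S" for n
  proof -
    obtain G :: "nat monoid" where G: "one_noncommutator G" "n = order G"
      using n unfolding S_def by blast
    obtain N where N: "one_noncommutator ((G \<times>\<times> G) Mod N)" "order G < order ((G \<times>\<times> G) Mod N)"
      using one_noncommutator_central_product[OF G(1)] by blast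
    obtain G' :: "nat monoid" where "one_noncommutator G'" "order G' = order ((G \<times>\<times> G) Mod N)"
      using one_noncommutator_nat[OF N(1)] by metis
    then show ?thesis using N(2) G(2) unfolding S_def by auto
  qed
  moreover obtain G1 :: "nat monoid" where "one_noncommutator G1"
    using one_noncommutator_nat[OF assms] by metis
  then have "S \<noteq> {}" unfolding S_def by blast
  ultimately have "infinite S"
    using Max_in Max_ge by (metis leD)
  define F where "F n = (SOME G :: nat monoid. one_noncommutator G \<and> order G = n)" for n
  have F: "one_noncommutator (F n) \<and> order (F n) = n" if "n \<in> S" for n
    unfolding F_def by (rule someI_ex) (use that S_def in blast)
  have "inj_on F S"
    using F by (metis inj_onI)
  then have "infinite (F ` S)"
    using \<open>infinite S\<close> finite_imageD by blast
  moreover have "\<not> F m \<cong> F n" if "m \<in> S" "n \<in> S" "F m \<noteq> F n" for m n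
    using iso_same_card[of "F m" "F n"] F[OF that(1)] F[OF that(2)] that(3) unfolding order_def by auto
  ultimately show ?thesis
    using F unfolding one_noncommutator_def by (intro exI[of _ "F ` S"]) auto
qed

section \<open>Subsets and permutations of two sixes\<close>

text \<open>\<open>T a b c d e f\<close> is the table of a function on six points: a subset when its entries are
  truth values, a permutation when they are points. Permutations act on subsets from the right,
  by composition.\<close>
datatype pt = P0 | P1 | P2 | P3 | P4 | P5
datatype 'a tab = T 'a 'a 'a 'a 'a 'a

fun app :: "'a tab \<Rightarrow> pt \<Rightarrow> 'a" where
  "app (T a b c d e f) P0 = a"
| "app (T a b c d e f) P1 = b"
| "app (T a b c d e f) P2 = c"
| "app (T a b c d e f) P3 = d"
| "app (T a b c d e f) P4 = e"
| "app (T a b c d e f) P5 = f"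

text \<open>As a permutation this is the identity.\<close>

definition pts :: "pt tab" where "pts = T P0 P1 P2 P3 P4 P5"

definition tcomp :: "'a tab \<Rightarrow> pt tab \<Rightarrow> 'a tab" where
  "tcomp v g = map_tab (app v) g"

fun tadd :: "bool tab \<Rightarrow> bool tab \<Rightarrow> bool tab" where
  "tadd (T a b c d e f) (T a' b' c' d' e' f') =
     T (a \<noteq> a') (b \<noteq> b') (c \<noteq> c') (d \<noteq> d') (e \<noteq> e') (f \<noteq> f')"

fun tand :: "bool tab \<Rightarrow> bool tab \<Rightarrow> bool tab" where
  "tand (T a b c d e f) (T a' b' c' d' e' f') =
     T (a \<and> a') (b \<and> b') (c \<and> c') (d \<and> d') (e \<and> e') (f \<and> f')"

definition tnot :: "bool tab \<Rightarrow> bool tab" where "tnot = map_tab Not"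

fun par :: "bool tab \<Rightarrow> bool" where
  "par (T a b c d e f) = (a \<noteq> (b \<noteq> (c \<noteq> (d \<noteq> (e \<noteq> f)))))"

definition tzero :: "bool tab" where "tzero = T False False False False False False"
definition tone :: "bool tab" where "tone = T True True True True True True"

lemma tab_eqI: "(\<And>x. app u x = app v x) \<Longrightarrow> u = v"
  by (cases u; cases v) (metis app.simps)

lemma app_tcomp [simp]: "app (tcomp v g) x = app v (app g x)"
  unfolding tcomp_def by (cases g; cases x) auto

lemma app_pts [simp]: "app pts x = x"
  by (cases x) (simp_all add: pts_def)

lemma app_tadd [simp]: "app (tadd u v) x = (app u x \<noteq> app v x)"
  by (cases u; cases v; cases x) auto

lemma app_tand [simp]: "app (tand u v) x = (app u x \<and> app v x)"
  by (cases u; cases v; cases x) auto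

lemma app_tnot [simp]: "app (tnot u) x = (\<not> app u x)"
  by (cases u; cases x) (auto simp: tnot_def)

lemma app_tzero [simp]: "app tzero x = False"
  by (cases x) (auto simp: tzero_def)

lemma app_tone [simp]: "app tone x = True"
  by (cases x) (auto simp: tone_def)

lemma par_tadd [simp]: "par (tadd u v) = (par u \<noteq> par v)"
  by (cases u; cases v) (simp only: tadd.simps par.simps; argo)

section \<open>Pairs of tables: vectors, permutations of both sixes, and \<open>A6\<close>\<close>

type_synonym perm = "pt tab \<times> pt tab"
type_synonym vec = "bool tab \<times> bool tab"

text \<open>Polymorphic, so that it is both the product of permutation pairs and their right action
  on vectors.\<close>

fun pmul :: "'a tab \<times> 'b tab \<Rightarrow> perm \<Rightarrow> 'a tab \<times> 'b tab" where
  "pmul (a, b) (c, d) = (tcomp a c, tcomp b d)"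

fun vadd :: "vec \<Rightarrow> vec \<Rightarrow> vec" where
  "vadd (a, b) (c, d) = (tadd a c, tadd b d)"

definition pone :: perm where "pone = (pts, pts)"
definition vzero :: vec where "vzero = (tzero, tzero)"

fun ev :: "vec \<Rightarrow> bool" where "ev (u, v) = (\<not> par u \<and> \<not> par v)"

lemma pmul_assoc: "pmul (pmul x g) h = pmul x (pmul g h)"
  by (cases x; cases g; cases h) (auto intro: tab_eqI)

lemma pmul_pone [simp]: "pmul x pone = x" "pmul pone g = g"
  by (cases x, auto simp: pone_def intro!: tab_eqI) (cases g, auto simp: pone_def intro!: tab_eqI)

lemma vadd_assoc: "vadd (vadd u v) w = vadd u (vadd v w)"
  by (cases u; cases v; cases w) (auto intro!: tab_eqI)

lemma vadd_commute: "vadd u v = vadd v u"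
  by (cases u; cases v) (auto intro!: tab_eqI)

lemma vadd_left_commute: "vadd u (vadd v w) = vadd v (vadd u w)"
  by (metis vadd_assoc vadd_commute)

lemma vadd_self [simp]: "vadd u u = vzero" "vadd u (vadd u v) = v"
  by (cases u; cases v; auto simp: vzero_def intro!: tab_eqI)+

lemma vadd_zero [simp]: "vadd u vzero = u" "vadd vzero u = u"
  by (cases u; auto simp: vzero_def intro!: tab_eqI)+

lemmas vadd_ac = vadd_assoc vadd_commute vadd_left_commute

lemma pmul_vadd: "pmul (vadd u v) g = vadd (pmul u g) (pmul v g)"
  by (cases u; cases v; cases g) (auto intro!: tab_eqI)

lemma pmul_vzero [simp]: "pmul vzero g = vzero"
  by (cases g) (auto simp: vzero_def intro!: tab_eqI)

lemma ev_vadd [simp]: "ev u \<Longrightarrow> ev v \<Longrightarrow> ev (vadd u v)"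
  by (cases u; cases v) auto

lemma ev_vzero [simp]: "ev vzero"
  by (simp add: vzero_def tzero_def)

text \<open>Two generators of the alternating group on the first six points, each paired with its image
  under an outer automorphism, that is, its action on the six synthematic totals.\<close>
definition gen_a :: perm where "gen_a = (T P1 P2 P3 P4 P0 P5, T P2 P0 P5 P3 P1 P4)"
definition gen_b :: perm where "gen_b = (T P0 P1 P2 P4 P5 P3, T P3 P2 P5 P4 P0 P1)"
text \<open>\<open>gen_a\<close> has order 5 and \<open>gen_b\<close> order 3, so these powers are
  the inverses.\<close>

definition gen_a' where "gen_a' = pmul gen_a (pmul gen_a (pmul gen_a gen_a))"
definition gen_b' where "gen_b' = pmul gen_b gen_b"

lemma gens_inverse:
  "pmul gen_a' gen_a = pone" "pmul gen_a gen_a' = pone" "pmul gen_b' gen_b = pone" "pmul gen_b gen_b' = pone"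
  by code_simp+

text \<open>Since the generators have finite order, the monoid they generate is a group. With left
  multiplication only, a list contains \<open>A6\<close> once it contains \<open>pone\<close> and is
  closed under two maps.\<close>

inductive_set A6 :: "perm set" where
  one: "pone \<in> A6"
| gen_a: "x \<in> A6 \<Longrightarrow> pmul gen_a x \<in> A6"
| gen_b: "x \<in> A6 \<Longrightarrow> pmul gen_b x \<in> A6"

lemma A6_mult: "x \<in> A6 \<Longrightarrow> y \<in> A6 \<Longrightarrow> pmul x y \<in> A6"
  by (induction rule: A6.induct) (auto simp: pmul_assoc intro: A6.intros)

lemma A6_gens: "gen_a \<in> A6" "gen_b \<in> A6" "gen_a' \<in> A6" "gen_b' \<in> A6"
  using A6.gen_a[OF A6.one] A6.gen_b[OF A6.one] by (auto simp: gen_a'_def gen_b'_def intro: A6.intros)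

lemma A6_inverse:
  assumes "x \<in> A6"
  shows "\<exists>y\<in>A6. pmul x y = pone \<and> pmul y x = pone"
  using assms
proof induction
  case one
  show ?case using A6.one by (intro bexI[of _ pone]) auto
next
  case (gen_a x)
  then obtain y where y: "y \<in> A6" "pmul x y = pone" "pmul y x = pone" by blast
  have "pmul (pmul gen_a x) (pmul y gen_a') = pone" "pmul (pmul y gen_a') (pmul gen_a x) = pone"
    using y by (metis gens_inverse pmul_assoc pmul_pone)+
  then show ?case using A6_mult[OF y(1) A6_gens(3)] by blast
next
  case (gen_b x)
  then obtain y where y: "y \<in> A6" "pmul x y = pone" "pmul y x = pone" by blast
  have "pmul (pmul gen_b x) (pmul y gen_b') = pone" "pmul (pmul y gen_b') (pmul gen_b x) = pone"
    using y by (metis gens_inverse pmul_assoc pmul_pone)+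
  then show ?case using A6_mult[OF y(1) A6_gens(4)] by blast
qed

lemma par_gens:
  "par (tcomp v (fst gen_a)) = par v" "par (tcomp v (snd gen_a)) = par v"
  "par (tcomp v (fst gen_b)) = par v" "par (tcomp v (snd gen_b)) = par v"
  by (cases v; simp only: gen_a_def gen_b_def tcomp_def fst_conv snd_conv tab.map app.simps par.simps; argo)+

lemma tcomp_assoc: "tcomp (tcomp u g) h = tcomp u (tcomp g h)"
  by (auto intro: tab_eqI)

lemma fst_pmul: "fst (pmul x g) = tcomp (fst x) (fst g)"
  and snd_pmul: "snd (pmul x g) = tcomp (snd x) (snd g)"
  by (cases x; cases g; simp)+

lemma par_A6: "g \<in> A6 \<Longrightarrow> par (tcomp v (fst g)) = par v \<and> par (tcomp v (snd g)) = par v"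
proof (induction arbitrary: v rule: A6.induct)
  case one
  have "tcomp v pts = v" by (auto intro: tab_eqI)
  then show ?case by (simp add: pone_def)
qed (simp_all add: fst_pmul snd_pmul par_gens flip: tcomp_assoc)

lemma ev_pmul [simp]: "g \<in> A6 \<Longrightarrow> ev (pmul v g) = ev v"
  using par_A6[of g] by (cases v; cases g) auto

definition word :: "perm list \<Rightarrow> perm" where "word xs = foldr pmul xs pone"

lemma word_in_A6: "set xs \<subseteq> {gen_a, gen_b} \<Longrightarrow> word xs \<in> A6"
  by (induction xs) (auto simp: word_def intro: A6.intros)

section \<open>Enumeration of A6\<close>

text \<open>The first argument is fuel: an orbit of size \<open>k\<close> needs \<open>2 * k + 1\<close> steps, and no conjugacy
  class of \<open>A6\<close> has more than 90 elements.\<close>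
fun orbit_list :: "nat \<Rightarrow> ('a \<Rightarrow> 'a) \<Rightarrow> ('a \<Rightarrow> 'a) \<Rightarrow> 'a list \<Rightarrow> 'a list \<Rightarrow> 'a list" where
  "orbit_list 0 f g seen todo = seen"
| "orbit_list (Suc n) f g seen [] = seen"
| "orbit_list (Suc n) f g seen (x # xs) = (if x \<in> set seen then orbit_list n f g seen xs
     else orbit_list n f g (x # seen) (f x # g x # xs))"

text \<open>This bounds the list from above, whatever the fuel; that the lists exhaust
  \<open>A6\<close> is certified separately by \<open>closed_check\<close>.\<close>

lemma orbit_list_invariant:
  assumes "\<And>x. Q x \<Longrightarrow> Q (f x)" "\<And>x. Q x \<Longrightarrow> Q (g x)"
    and "x \<in> set (orbit_list n f g seen todo)" "\<And>y. y \<in> set seen \<union> set todo \<Longrightarrow> Q y"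
  shows "Q x"
  using assms(3,4)
proof (induction n arbitrary: seen todo)
  case (Suc n)
  show ?case
  proof (cases todo)
    case Nil
    then show ?thesis using Suc.prems by auto
  next
    case (Cons y ys)
    show ?thesis
    proof (cases "y \<in> set seen")
      case True
      then show ?thesis
        using Suc.IH[of seen ys] Suc.prems Cons by auto
    next
      case False
      then show ?thesis
        using Suc.IH[of "y # seen" "f y # g y # ys"] Suc.prems Cons assms(1,2) by auto
    qed
  qed
qed simp

definition rep2 where "rep2 = word [gen_a, gen_a, gen_a, gen_a, gen_b, gen_b, gen_a, gen_b]"
definition rep3 where "rep3 = word [gen_a, gen_a, gen_b, gen_b]"
definition rep4 where "rep4 = word [gen_a, gen_a, gen_a, gen_b, gen_a, gen_b, gen_a, gen_a, gen_b]"
definition rep5 where "rep5 = word [gen_a, gen_a]"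
text \<open>The nontrivial conjugacy classes of \<open>A6\<close>, with element orders 5, 5, 3, 3,
  2, 4. On the first six \<open>gen_b\<close> is a 3-cycle and \<open>rep3\<close> a product of two;
  on the second six it is the other way round.\<close>

definition reps where "reps = [gen_a, rep5, gen_b, rep3, rep2, rep4]"

definition conj_a :: "perm \<Rightarrow> perm" where "conj_a x = pmul gen_a' (pmul x gen_a)"
definition conj_b :: "perm \<Rightarrow> perm" where "conj_b x = pmul gen_b' (pmul x gen_b)"

definition elems :: "perm list" where
  "elems = pone # concat (map (\<lambda>c. orbit_list 185 conj_a conj_b [] [c]) reps)"

text \<open>Sorting the elements by the images of two points only serves to speed up membership tests.\<close>
definition buckets :: "perm list \<Rightarrow> perm list tab tab" where
  "buckets xs = map_tab (\<lambda>i. map_tab (\<lambda>j. filter (\<lambda>x. app (fst x) P1 = j)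
      (filter (\<lambda>x. app (fst x) P0 = i) xs)) pts) pts"

definition bucket_member :: "perm list tab tab \<Rightarrow> perm \<Rightarrow> bool" where
  "bucket_member B x \<longleftrightarrow> x \<in> set (app (app B (app (fst x) P0)) (app (fst x) P1))"

definition closed_check :: "perm list tab tab \<Rightarrow> perm list \<Rightarrow> bool" where
  "closed_check B xs \<longleftrightarrow> list_all (\<lambda>x. bucket_member B (pmul gen_a x) \<and> bucket_member B (pmul gen_b x)) xs"

definition pt_list :: "pt list" where "pt_list = [P0, P1, P2, P3, P4, P5]"

text \<open>Transitivity on pairs of points from different sixes, and double transitivity on each
  six.\<close>

definition transitive_check :: "perm list \<Rightarrow> bool" where
  "transitive_check xs \<longleftrightarrow> list_all (\<lambda>i. list_all (\<lambda>j.
      list_ex (\<lambda>x. app (fst x) P0 = i \<and> app (snd x) P0 = j) xs \<and>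
      (i = j \<or> list_ex (\<lambda>x. app (fst x) P0 = i \<and> app (fst x) P1 = j) xs \<and>
                 list_ex (\<lambda>x. app (snd x) P0 = i \<and> app (snd x) P1 = j) xs)) pt_list) pt_list"

text \<open>Complements of odd sets are odd, so it suffices to list those avoiding \<open>P5\<close>.\<close>
definition odds :: "bool tab list" where
  "odds = concat (map (\<lambda>b. concat (map (\<lambda>c. concat (map (\<lambda>d. concat (map (\<lambda>e.
     [T (\<not> (b \<noteq> (c \<noteq> (d \<noteq> e)))) b c d e False])
     [False, True])) [False, True])) [False, True])) [False, True])"

definition preserves_split :: "bool tab \<Rightarrow> pt tab \<Rightarrow> bool" where
  "preserves_split S g \<longleftrightarrow> tcomp S g = S \<or> tcomp S g = tnot S"

definition odd_set_check :: "perm \<Rightarrow> perm \<Rightarrow> bool" where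
  "odd_set_check a b \<longleftrightarrow> list_ex (\<lambda>S.
     preserves_split S (fst a) \<and> preserves_split S (fst b) \<or>
     preserves_split S (snd a) \<and> preserves_split S (snd b)) odds"

text \<open>Commuting pairs matter only up to simultaneous conjugation, so the first member runs
  over \<open>reps\<close>.\<close>

definition commuting_check :: "perm list \<Rightarrow> bool" where
  "commuting_check xs \<longleftrightarrow> list_all (\<lambda>c. list_all (\<lambda>x. pmul c x \<noteq> pmul x c \<or> odd_set_check c x) xs) reps"

definition elems_check :: "perm list \<Rightarrow> bool" where
  "elems_check xs \<longleftrightarrow> closed_check (buckets xs) xs \<and> transitive_check xs \<and> commuting_check xs"

lemma elems_check_holds: "elems_check elems"
  by code_simp

lemma reps_in_A6: "c \<in> set reps \<Longrightarrow> c \<in> A6"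
  by (auto simp: reps_def rep2_def rep3_def rep4_def rep5_def A6_gens intro!: word_in_A6)

lemma conj_in_A6: "x \<in> A6 \<Longrightarrow> conj_a x \<in> A6" "x \<in> A6 \<Longrightarrow> conj_b x \<in> A6"
  by (auto simp: conj_a_def conj_b_def intro!: A6_mult A6_gens)

lemma elems_cases:
  assumes "x \<in> set elems"
  obtains "x = pone" | c where "c \<in> set reps" "x \<in> set (orbit_list 185 conj_a conj_b [] [c])"
  using assms by (auto simp: elems_def simp del: orbit_list.simps)

lemma elems_in_A6: "x \<in> A6" if "x \<in> set elems"
  using that
proof (cases rule: elems_cases)
  case (2 c)
  then show ?thesis
    using orbit_list_invariant[of "\<lambda>x. x \<in> A6" conj_a conj_b x 185 "[]" "[c]"]
      conj_in_A6 reps_in_A6 by (simp del: orbit_list.simps)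
qed (simp add: A6.one)

lemma app_map_tab: "app (map_tab f t) i = f (app t i)"
  by (cases t; cases i) auto

lemma bucket_member_buckets: "bucket_member (buckets xs) x \<Longrightarrow> x \<in> set xs"
  by (simp add: bucket_member_def buckets_def app_map_tab)

lemma A6_in_elems: "x \<in> A6 \<Longrightarrow> x \<in> set elems"
proof (induction rule: A6.induct)
  case one
  show ?case by (simp add: elems_def)
next
  case (gen_a x)
  then show ?case
    using elems_check_holds bucket_member_buckets by (auto simp: elems_check_def closed_check_def list_all_iff)
next
  case (gen_b x)
  then show ?case
    using elems_check_holds bucket_member_buckets by (auto simp: elems_check_def closed_check_def list_all_iff)
qed

text \<open>Each nontrivial element lies in one of the listed orbits under conjugation by the
  generators, so a conjugation-invariant property need only be checked on six elements.\<close>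

lemma A6_class_induct:
  assumes "x \<in> A6" "x \<noteq> pone"
    and "\<And>c. c \<in> set reps \<Longrightarrow> Q c"
    and "\<And>x. Q x \<Longrightarrow> Q (conj_a x)" "\<And>x. Q x \<Longrightarrow> Q (conj_b x)"
  shows "Q x"
  using A6_in_elems[OF assms(1)]
proof (cases rule: elems_cases)
  case (2 c)
  then show ?thesis
    using orbit_list_invariant[of Q conj_a conj_b x 185 "[]" "[c]"] assms(3-5) by (simp del: orbit_list.simps)
qed (use assms(2) in simp)

lemma finite_A6: "finite A6"
  by (rule finite_subset[of _ "set elems"]) (auto intro: A6_in_elems)

lemma pt_list_UNIV: "i \<in> set pt_list"
  by (cases i) (auto simp: pt_list_def)

lemma A6_transitive:
  "\<exists>k\<in>A6. app (fst k) P0 = i \<and> app (snd k) P0 = j"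
  "i \<noteq> j \<Longrightarrow> \<exists>k\<in>A6. app (fst k) P0 = i \<and> app (fst k) P1 = j"
  "i \<noteq> j \<Longrightarrow> \<exists>k\<in>A6. app (snd k) P0 = i \<and> app (snd k) P1 = j"
  using elems_check_holds elems_in_A6 pt_list_UNIV[of i] pt_list_UNIV[of j]
  unfolding elems_check_def transitive_check_def list_all_iff list_ex_iff by blast+

section \<open>The pair of full sets is not a commutator\<close>

text \<open>In the group of pairs \<open>(v, g)\<close> with \<open>(u, a) (v, b) = (u \<circ> b + v, a b)\<close>, the equation
  \<open>x = A\<^sup>-\<^sup>1 B\<^sup>-\<^sup>1 A B\<close> reads \<open>B A x = A B\<close>; \<open>reach\<close> and \<open>Com\<close> are its two components for
  \<open>x = (v, c)\<close>, \<open>A = (u, a)\<close>, \<open>B = (w, b)\<close>.\<close>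
definition reach :: "perm \<Rightarrow> perm \<Rightarrow> perm \<Rightarrow> vec set" where
  "reach a b c = {v. \<exists>u w. ev u \<and> ev w \<and>
     v = vadd (vadd (pmul (vadd (pmul w a) u) c) (pmul u b)) w}"

definition Com :: "vec \<Rightarrow> perm \<Rightarrow> bool" where
  "Com v c \<longleftrightarrow> (\<exists>a\<in>A6. \<exists>b\<in>A6. pmul b (pmul a c) = pmul a b \<and> v \<in> reach a b c)"

definition vone :: vec where "vone = (tone, tone)"

section \<open>Odd sets preserved up to complement by commuting pairs\<close>

definition common_odd_set :: "perm \<Rightarrow> perm \<Rightarrow> bool" where
  "common_odd_set a b \<longleftrightarrow> (\<exists>S. par S \<and>
     (preserves_split S (fst a) \<and> preserves_split S (fst b) \<or>
      preserves_split S (snd a) \<and> preserves_split S (snd b)))"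

lemma tnot_tcomp: "tcomp (tnot S) g = tnot (tcomp S g)"
  by (auto intro: tab_eqI)

lemma preserves_split_conj:
  assumes "preserves_split S g" "tcomp k k' = pts"
  shows "preserves_split (tcomp S k) (tcomp k' (tcomp g k))"
proof -
  have "tcomp S pts = S" by (auto intro: tab_eqI)
  then have "tcomp (tcomp S k) (tcomp k' (tcomp g k)) = tcomp (tcomp S g) k"
    using assms(2) by (metis tcomp_assoc)
  then show ?thesis
    using assms(1) by (auto simp: preserves_split_def tnot_tcomp)
qed

text \<open>The set \<open>S\<close> moves along to \<open>S\<close> composed with \<open>k\<close>,
  on the same six, and stays odd because \<open>A6\<close> preserves parity.\<close>

lemma common_odd_set_conj:
  assumes "common_odd_set a b" "k \<in> A6" "pmul k k' = pone"
  shows "common_odd_set (pmul k' (pmul a k)) (pmul k' (pmul b k))"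
proof -
  obtain S where S: "par S" "preserves_split S (fst a) \<and> preserves_split S (fst b) \<or>
    preserves_split S (snd a) \<and> preserves_split S (snd b)"
    using assms(1) common_odd_set_def by blast
  have k: "tcomp (fst k) (fst k') = pts" "tcomp (snd k) (snd k') = pts"
    using assms(3) by (metis fst_pmul snd_pmul pone_def fst_conv snd_conv)+
  show ?thesis
    using S(2)
  proof
    assume "preserves_split S (fst a) \<and> preserves_split S (fst b)"
    then show ?thesis
      unfolding common_odd_set_def fst_pmul snd_pmul using k preserves_split_conj par_A6[OF assms(2)] S(1) by metis
  next
    assume "preserves_split S (snd a) \<and> preserves_split S (snd b)"
    then show ?thesis
      unfolding common_odd_set_def fst_pmul snd_pmul using k preserves_split_conj par_A6[OF assms(2)] S(1) by metis
  qed
qed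

lemma par_odds: "list_all par odds"
  by code_simp

lemma common_odd_set_reps:
  assumes "c \<in> set reps" "b \<in> A6" "pmul c b = pmul b c"
  shows "common_odd_set c b"
proof -
  have "odd_set_check c b"
    using elems_check_holds assms A6_in_elems unfolding elems_check_def commuting_check_def list_all_iff by blast
  then show ?thesis
    using par_odds unfolding odd_set_check_def common_odd_set_def list_ex_iff list_all_iff by blast
qed

lemma pmul_inverse_left:
  assumes "pmul k k' = pone"
  shows "pmul k (pmul k' x) = x"
  using assms by (simp flip: pmul_assoc)

lemma common_odd_set_commuting_ne:
  assumes "a \<in> A6" "a \<noteq> pone" "b \<in> A6" "pmul a b = pmul b a"
  shows "common_odd_set a b"
proof -
  \<comment> \<open>Quantifying over \<open>b\<close> makes the property invariant under conjugation
    of \<open>a\<close>: the partner is conjugated back by \<open>k\<close>.\<close>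
  define Q where "Q a \<longleftrightarrow> (\<forall>b\<in>A6. pmul a b = pmul b a \<longrightarrow> common_odd_set a b)" for a
  have step: "Q (pmul k' (pmul a k))"
    if "Q a" and k: "k \<in> A6" "k' \<in> A6" "pmul k k' = pone" "pmul k' k = pone" for a k k'
    unfolding Q_def
  proof (intro ballI impI)
    fix b
    assume b: "b \<in> A6" "pmul (pmul k' (pmul a k)) b = pmul b (pmul k' (pmul a k))"
    let ?b = "pmul k (pmul b k')"
    have eq: "pmul k' (pmul ?b k) = b"
      using k by (simp add: pmul_assoc pmul_inverse_left)
    have "pmul k (pmul (pmul (pmul k' (pmul a k)) b) k') = pmul k (pmul (pmul b (pmul k' (pmul a k))) k')"
      using b by simp
    then have "pmul a ?b = pmul ?b a"
      using k by (simp add: pmul_assoc pmul_inverse_left)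
    moreover have "?b \<in> A6"
      using k b by (auto intro!: A6_mult)
    ultimately have "common_odd_set a ?b"
      using \<open>Q a\<close> by (simp add: Q_def)
    from common_odd_set_conj[OF this k(1) k(3)] show "common_odd_set (pmul k' (pmul a k)) b"
      using eq by simp
  qed
  have "Q a"
    using assms(1,2)
  proof (rule A6_class_induct)
    show "Q c" if "c \<in> set reps" for c
      using common_odd_set_reps that by (simp add: Q_def)
  qed (auto simp: conj_a_def conj_b_def gens_inverse A6_gens intro: step)
  then show ?thesis
    using assms by (simp add: Q_def)
qed

lemma preserves_split_pts: "preserves_split S pts"
  by (auto simp: preserves_split_def intro: tab_eqI)

lemma common_odd_set_commuting:
  assumes "a \<in> A6" "b \<in> A6" "pmul a b = pmul b a"
  shows "common_odd_set a b"
proof (cases "a = pone")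
  case False
  then show ?thesis using common_odd_set_commuting_ne assms by blast
next
  case a: True
  show ?thesis
  proof (cases "b = pone")
    case True
    have "par (T True False False False False False)" by simp
    then show ?thesis
      unfolding common_odd_set_def using a True preserves_split_pts by (metis pone_def fst_conv)
  next
    case False
    \<comment> \<open>An odd set for the pair \<open>b\<close>, \<open>b\<close> also serves for the
      identity and \<open>b\<close>, as the identity preserves every set.\<close>
    then have "common_odd_set b b" using common_odd_set_commuting_ne assms by blast
    then show ?thesis
      unfolding common_odd_set_def using a preserves_split_pts by (metis pone_def fst_conv snd_conv)
  qed
qed

text \<open>If \<open>g\<close> exchanges \<open>S\<close> with its complement, the two parities agree because \<open>u\<close> is even.\<close>
lemma par_preserves_split:
  assumes "preserves_split S g" "\<And>v. par (tcomp v g) = par v" "\<not> par u"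
  shows "par (tand S (tcomp u g)) = par (tand S u)"
  using assms(1) unfolding preserves_split_def
proof
  assume "tcomp S g = S"
  then have "tand S (tcomp u g) = tcomp (tand S u) g"
    by (intro tab_eqI) (metis app_tand app_tcomp)
  then show ?thesis using assms(2) by simp
next
  assume "tcomp S g = tnot S"
  then have "tand S (tcomp u g) = tcomp (tadd (tand S u) u) g"
    by (intro tab_eqI) (metis (full_types) app_tadd app_tand app_tcomp app_tnot)
  then show ?thesis using assms(2,3) by simp
qed

lemma tand_tadd: "tand S (tadd u v) = tadd (tand S u) (tand S v)"
  by (auto intro: tab_eqI)

lemma tand_tone: "tand S tone = S"
  by (auto intro: tab_eqI)

text \<open>On intersection with \<open>S\<close>, \<open>tcomp w a\<close> has the parity of
  \<open>w\<close>, and \<open>tcomp u b\<close> that of \<open>u\<close>. The sum therefore meets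
  \<open>S\<close> evenly, while \<open>tone\<close> meets it in the odd set
  \<open>S\<close>.\<close>

lemma par_not_reached:
  assumes "par S" "preserves_split S a" "preserves_split S b" "\<not> par u" "\<not> par w"
    and "\<And>v. par (tcomp v a) = par v" "\<And>v. par (tcomp v b) = par v"
  shows "tone \<noteq> tadd (tadd (tadd (tcomp w a) u) (tcomp u b)) w"
proof
  assume "tone = tadd (tadd (tadd (tcomp w a) u) (tcomp u b)) w"
  then have "par (tand S tone) = par (tand S (tadd (tadd (tadd (tcomp w a) u) (tcomp u b)) w))"
    by simp
  then show False
    using assms by (simp add: tand_tadd tand_tone par_preserves_split) blast
qed

lemma not_Com_vone: "\<not> Com vone pone"
proof
  assume "Com vone pone"
  then obtain a b where ab: "a \<in> A6" "b \<in> A6" "pmul a b = pmul b a" "vone \<in> reach a b pone"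
    unfolding Com_def by auto
  then obtain u w where uw: "ev u" "ev w" "vone = vadd (vadd (vadd (pmul w a) u) (pmul u b)) w"
    by (auto simp: reach_def)
  obtain S where S: "par S" "preserves_split S (fst a) \<and> preserves_split S (fst b) \<or>
    preserves_split S (snd a) \<and> preserves_split S (snd b)"
    using common_odd_set_commuting[OF ab(1-3)] common_odd_set_def by blast
  have "tone = tadd (tadd (tadd (tcomp (fst w) (fst a)) (fst u)) (tcomp (fst u) (fst b))) (fst w)"
    "tone = tadd (tadd (tadd (tcomp (snd w) (snd a)) (snd u)) (tcomp (snd u) (snd b))) (snd w)"
    using uw(3) by (cases u; cases w; cases a; cases b; simp add: vone_def)+
  moreover have "\<not> par (fst u)" "\<not> par (snd u)" "\<not> par (fst w)" "\<not> par (snd w)"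
    using uw(1,2) by (cases u; cases w; simp)+
  ultimately show False
    using S par_not_reached par_A6[OF ab(1)] par_A6[OF ab(2)] by metis
qed

section \<open>All other elements are commutators\<close>

definition closed_add :: "vec set \<Rightarrow> bool" where
  "closed_add X \<longleftrightarrow> vzero \<in> X \<and> (\<forall>x\<in>X. \<forall>y\<in>X. vadd x y \<in> X)"

text \<open>For fixed \<open>a\<close>, \<open>b\<close>, \<open>c\<close> the defining expression
  is linear in \<open>(u, w)\<close>.\<close>

lemma closed_add_reach: "closed_add (reach a b c)"
  unfolding closed_add_def
proof (intro conjI ballI)
  have "vzero = vadd (vadd (pmul (vadd (pmul vzero a) vzero) c) (pmul vzero b)) vzero"
    by simp
  then show "vzero \<in> reach a b c"
    unfolding reach_def using ev_vzero by blast
next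
  fix x y
  assume "x \<in> reach a b c" "y \<in> reach a b c"
  then obtain u w u' w' where e: "ev u" "ev w" "ev u'" "ev w'"
    and x: "x = vadd (vadd (pmul (vadd (pmul w a) u) c) (pmul u b)) w"
    and y: "y = vadd (vadd (pmul (vadd (pmul w' a) u') c) (pmul u' b)) w'"
    unfolding reach_def by blast
  have "vadd x y = vadd (vadd (pmul (vadd (pmul (vadd w w') a) (vadd u u')) c)
      (pmul (vadd u u') b)) (vadd w w')"
    unfolding x y by (simp add: pmul_vadd vadd_ac)
  then show "vadd x y \<in> reach a b c"
    unfolding reach_def using e ev_vadd by blast
qed

text \<open>Gaussian elimination: a generator with coordinate \<open>i\<close> becomes the pivot and
  is added to all generators and targets having that coordinate, itself included, which turns it
  into zero. Targets that end at zero lie in the span of the generators.\<close>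

fun elim_to_zero :: "(vec \<Rightarrow> bool) list \<Rightarrow> vec list \<Rightarrow> vec list \<Rightarrow> bool" where
  "elim_to_zero [] gs ts = list_all (\<lambda>t. t = vzero) ts"
| "elim_to_zero (i # is) gs ts = (case filter i gs of [] \<Rightarrow> elim_to_zero is gs ts
     | p # _ \<Rightarrow> elim_to_zero is (map (\<lambda>x. if i x then vadd p x else x) gs)
                       (map (\<lambda>x. if i x then vadd p x else x) ts))"

lemma elim_sound:
  assumes X: "closed_add X"
  shows "elim_to_zero is gs ts \<Longrightarrow> set gs \<subseteq> X \<Longrightarrow> set ts \<subseteq> X"
proof (induction "is" gs ts rule: elim_to_zero.induct)
  case (1 gs ts)
  then show ?case
    using X by (auto simp: closed_add_def list_all_iff)
next
  case (2 i "is" gs ts)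
  show ?case
  proof (cases "filter i gs")
    case Nil
    then show ?thesis using 2 by simp
  next
    case (Cons p ps)
    then have p: "p \<in> X"
      using 2 by (metis filter_eq_ConsD in_set_conv_decomp subsetD)
    let ?f = "\<lambda>x. if i x then vadd p x else x"
    have "set (map ?f gs) \<subseteq> X"
      using p 2(4) X by (auto simp: closed_add_def)
    then have "set (map ?f ts) \<subseteq> X"
      using 2(2)[OF Cons] 2(3) Cons by simp
    \<comment> \<open>Adding the pivot a second time undoes the reduction.\<close>
    moreover have "x \<in> X" if "?f x \<in> X" for x
      using that p X unfolding closed_add_def by (metis vadd_self(2))
    ultimately show ?thesis by fastforce
  qed
qed

definition pair :: "pt \<Rightarrow> pt \<Rightarrow> bool tab" where
  "pair i j = map_tab (\<lambda>x. x = i \<or> x = j) pts"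

definition left :: "bool tab \<Rightarrow> vec" where "left u = (u, tzero)"
definition right :: "bool tab \<Rightarrow> vec" where "right u = (tzero, u)"

text \<open>Bases of spaces of even sets: \<open>chain0\<close> of all, \<open>chain1\<close> of
  those avoiding \<open>P0\<close>, \<open>chain2\<close> of those avoiding \<open>P0\<close> and
  \<open>P1\<close>, \<open>skip1\<close> of those avoiding \<open>P1\<close>, \<open>joint\<close>
  of those containing both or neither of \<open>P0\<close> and \<open>P1\<close>.\<close>

definition chain2 where "chain2 = [pair P2 P3, pair P3 P4, pair P4 P5]"
definition chain1 where "chain1 = pair P1 P2 # chain2"
definition chain0 where "chain0 = pair P0 P1 # chain1"
definition skip1 where "skip1 = pair P0 P2 # chain2"
definition joint where "joint = pair P0 P1 # chain2"

definition basis :: "vec list" where "basis = map left chain0 @ map right chain0"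

text \<open>On even sets the entry at \<open>P5\<close> is determined by the other five.\<close>

definition coords :: "(vec \<Rightarrow> bool) list" where
  "coords = concat (map (\<lambda>i. [\<lambda>v. app (fst v) i, \<lambda>v. app (snd v) i]) [P0, P1, P2, P3, P4])"

text \<open>The values of the linear map behind \<open>reach\<close> at \<open>(e, vzero)\<close>
  and at \<open>(vzero, e)\<close>.\<close>

definition gens :: "perm \<Rightarrow> perm \<Rightarrow> perm \<Rightarrow> vec list" where
  "gens a b c = map (\<lambda>e. vadd (pmul e c) (pmul e b)) basis @
                map (\<lambda>e. vadd (pmul (pmul e a) c) e) basis"

definition reach_check :: "perm \<Rightarrow> perm \<Rightarrow> perm \<Rightarrow> vec list \<Rightarrow> bool" where
  "reach_check a b c ts \<longleftrightarrow> pmul b (pmul a c) = pmul a b \<and> elim_to_zero coords (gens a b c) ts"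

lemma ev_basis: "list_all ev basis" by code_simp

lemma gens_reach: "set (gens a b c) \<subseteq> reach a b c"
proof -
  have "vadd (pmul e c) (pmul e b) \<in> reach a b c" "vadd (pmul (pmul e a) c) e \<in> reach a b c"
    if "e \<in> set basis" for e
  proof -
    have e: "ev e" using that ev_basis by (auto simp: list_all_iff)
    show "vadd (pmul e c) (pmul e b) \<in> reach a b c"
      unfolding reach_def using e by (intro CollectI exI[of _ e] exI[of _ vzero]) simp
    show "vadd (pmul (pmul e a) c) e \<in> reach a b c"
      unfolding reach_def using e by (intro CollectI exI[of _ vzero] exI[of _ e]) simp
  qed
  then show ?thesis by (auto simp: gens_def)
qed

lemma reach_check_Com:
  assumes "reach_check a b c ts" "a \<in> A6" "b \<in> A6"
  obtains X where "closed_add X" "set ts \<subseteq> X" "\<And>v. v \<in> X \<Longrightarrow> Com v c"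
  using that[of "reach a b c"] closed_add_reach elim_sound gens_reach assms
  unfolding reach_check_def Com_def by metis

text \<open>The coefficients with respect to consecutive pairs are the prefix parities; evenness
  makes the last entry come out right. The first two pairs are demanded only when their coefficients
  are nonzero, so that \<open>chain0\<close>, \<open>chain1\<close>, \<open>chain2\<close> and
  \<open>joint\<close> are all covered.\<close>

lemma tab_in_span:
  assumes Y: "tzero \<in> Y" "\<And>x y. x \<in> Y \<Longrightarrow> y \<in> Y \<Longrightarrow> tadd x y \<in> Y"
    and ev: "\<not> par (T a b c d e f)"
    and 1: "a \<Longrightarrow> pair P0 P1 \<in> Y" "a \<noteq> b \<Longrightarrow> pair P1 P2 \<in> Y"
    and 2: "set chain2 \<subseteq> Y"
  shows "T a b c d e f \<in> Y"
proof -
  let ?s = "\<lambda>k p. if k then p else tzero"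
  have p: "pair P2 P3 \<in> Y" "pair P3 P4 \<in> Y" "pair P4 P5 \<in> Y"
    using 2 by (auto simp: chain2_def)
  have "T a b c d e f = tadd (?s a (pair P0 P1)) (tadd (?s (a \<noteq> b) (pair P1 P2))
     (tadd (?s (a \<noteq> (b \<noteq> c)) (pair P2 P3)) (tadd (?s (a \<noteq> (b \<noteq> (c \<noteq> d))) (pair P3 P4))
     (?s (a \<noteq> (b \<noteq> (c \<noteq> (d \<noteq> e)))) (pair P4 P5)))))"
    using ev by (cases a; cases b; cases c; cases d; cases e; cases f)
      (simp_all add: pair_def pts_def tzero_def)
  moreover have "?s k q \<in> Y" if "k \<Longrightarrow> q \<in> Y" for k q
    using that Y by simp
  ultimately show ?thesis
    using Y(2) 1 p by presburger
qed

lemma tab_in_span':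
  assumes Y: "tzero \<in> Y" "\<And>x y. x \<in> Y \<Longrightarrow> y \<in> Y \<Longrightarrow> tadd x y \<in> Y"
    and ev: "\<not> par (T a False c d e f)" and 1: "set skip1 \<subseteq> Y"
  shows "T a False c d e f \<in> Y"
proof -
  let ?s = "\<lambda>k p. if k then p else tzero"
  have p: "pair P0 P2 \<in> Y" "set chain2 \<subseteq> Y"
    using 1 by (auto simp: skip1_def)
  have "T False False (a \<noteq> c) d e f \<in> Y"
    using Y ev p by (intro tab_in_span) (auto simp: skip1_def)
  moreover have "?s a (pair P0 P2) \<in> Y"
    using p Y by simp
  moreover have "T a False c d e f = tadd (?s a (pair P0 P2)) (T False False (a \<noteq> c) d e f)"
    by (simp add: pair_def pts_def tzero_def)
  ultimately show ?thesis
    using Y(2) by metis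
qed

text \<open>Conjugation by \<open>(vzero, k)\<close> in the semidirect product; the witnesses
  \<open>u\<close> and \<open>w\<close> become \<open>pmul u k\<close> and
  \<open>pmul w k\<close>.\<close>

lemma Com_conj:
  assumes "Com v c" "k \<in> A6" "k' \<in> A6" "pmul k k' = pone"
  shows "Com (pmul v k) (pmul k' (pmul c k))"
proof -
  obtain a b where ab: "a \<in> A6" "b \<in> A6" "pmul b (pmul a c) = pmul a b" "v \<in> reach a b c"
    using assms(1) Com_def by blast
  then obtain u w where uw: "ev u" "ev w" "v = vadd (vadd (pmul (vadd (pmul w a) u) c) (pmul u b)) w"
    by (auto simp: reach_def)
  let ?a = "pmul k' (pmul a k)" and ?b = "pmul k' (pmul b k)" and ?c = "pmul k' (pmul c k)"
  note s = pmul_assoc pmul_inverse_left[OF assms(4)]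
  have "pmul ?b (pmul ?a ?c) = pmul k' (pmul (pmul b (pmul a c)) k)"
    by (simp add: s)
  also have "\<dots> = pmul ?a ?b"
    unfolding ab(3) by (simp add: s)
  finally have 1: "pmul ?b (pmul ?a ?c) = pmul ?a ?b" .
  have "pmul v k = vadd (vadd (pmul (vadd (pmul (pmul w k) ?a) (pmul u k)) ?c) (pmul (pmul u k) ?b)) (pmul w k)"
    unfolding uw(3) by (simp add: s pmul_vadd)
  moreover have "ev (pmul u k)" "ev (pmul w k)"
    using uw assms(2) by simp_all
  ultimately have "pmul v k \<in> reach ?a ?b ?c"
    unfolding reach_def by blast
  then show ?thesis
    unfolding Com_def using 1 assms ab A6_mult by meson
qed

lemma Com_pone_conj:
  assumes "Com (pmul v k) pone" "k \<in> A6"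
  shows "Com v pone"
proof -
  obtain k' where k': "k' \<in> A6" "pmul k k' = pone" "pmul k' k = pone"
    using A6_inverse assms(2) by blast
  then show ?thesis
    using Com_conj[OF assms(1) k'(1) assms(2) k'(3)] by (simp add: pmul_assoc)
qed

lemma vadd_left_right: "(u, v) = vadd (left u) (right v)"
  by (auto simp: left_def right_def intro!: tab_eqI)

lemma pair_in_closed:
  assumes "closed_add X" "left u \<in> X" "right v \<in> X"
  shows "(u, v) \<in> X"
  using assms unfolding closed_add_def by (metis vadd_left_right)

lemma closed_left:
  assumes "closed_add X"
  shows "tzero \<in> {u. left u \<in> X}" "x \<in> {u. left u \<in> X} \<Longrightarrow> y \<in> {u. left u \<in> X} \<Longrightarrow> tadd x y \<in> {u. left u \<in> X}"
proof -
  have "left (tadd x y) = vadd (left x) (left y)" for x y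
    by (auto simp: left_def intro!: tab_eqI)
  then show "x \<in> {u. left u \<in> X} \<Longrightarrow> y \<in> {u. left u \<in> X} \<Longrightarrow> tadd x y \<in> {u. left u \<in> X}"
    using assms by (simp add: closed_add_def)
qed (use assms in \<open>simp add: closed_add_def left_def vzero_def\<close>)

lemma closed_right:
  assumes "closed_add X"
  shows "tzero \<in> {u. right u \<in> X}" "x \<in> {u. right u \<in> X} \<Longrightarrow> y \<in> {u. right u \<in> X} \<Longrightarrow> tadd x y \<in> {u. right u \<in> X}"
proof -
  have "right (tadd x y) = vadd (right x) (right y)" for x y
    by (auto simp: right_def intro!: tab_eqI)
  then show "x \<in> {u. right u \<in> X} \<Longrightarrow> y \<in> {u. right u \<in> X} \<Longrightarrow> tadd x y \<in> {u. right u \<in> X}"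
    using assms by (simp add: closed_add_def)
qed (use assms in \<open>simp add: closed_add_def right_def vzero_def\<close>)

definition spans :: "bool tab list \<Rightarrow> bool tab \<Rightarrow> bool" where
  "spans B u \<longleftrightarrow> (\<forall>Y. tzero \<in> Y \<and> (\<forall>x\<in>Y. \<forall>y\<in>Y. tadd x y \<in> Y) \<and> set B \<subseteq> Y \<longrightarrow> u \<in> Y)"

lemma spans_Com:
  assumes "reach_check a b c (map left B @ map right B')" "a \<in> A6" "b \<in> A6"
    and "spans B u" "spans B' v"
  shows "Com (u, v) c"
proof -
  obtain X where X: "closed_add X" "set (map left B @ map right B') \<subseteq> X" "\<And>v. v \<in> X \<Longrightarrow> Com v c"
    using reach_check_Com[OF assms(1-3)] by blast
  have "set B \<subseteq> {u. left u \<in> X}" "set B' \<subseteq> {u. right u \<in> X}"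
    using X(2) by auto
  then have "u \<in> {u. left u \<in> X}" "v \<in> {u. right u \<in> X}"
    using assms(4,5) closed_left[OF X(1)] closed_right[OF X(1)] unfolding spans_def by metis+
  then show ?thesis
    using X pair_in_closed by blast
qed

lemma spans_chain0: "\<not> par u \<Longrightarrow> spans chain0 u"
  by (cases u) (auto simp: spans_def chain0_def chain1_def simp del: par.simps intro!: tab_in_span)

lemma spans_chain1: "\<not> par u \<Longrightarrow> \<not> app u P0 \<Longrightarrow> spans chain1 u"
  by (cases u) (auto simp: spans_def chain1_def simp del: par.simps intro!: tab_in_span)

lemma spans_joint: "\<not> par u \<Longrightarrow> app u P0 = app u P1 \<Longrightarrow> spans joint u"
  by (cases u) (auto simp: spans_def joint_def simp del: par.simps intro!: tab_in_span)

lemma spans_chain2: "\<not> par u \<Longrightarrow> \<not> app u P0 \<Longrightarrow> \<not> app u P1 \<Longrightarrow> spans chain2 u"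
  by (cases u) (auto simp: spans_def simp del: par.simps intro!: tab_in_span)

lemma spans_skip1: "\<not> par u \<Longrightarrow> \<not> app u P1 \<Longrightarrow> spans skip1 u"
  by (cases u) (auto simp: spans_def simp del: par.simps intro!: tab_in_span')

lemma spans_singleton: "spans [u] u"
  by (simp add: spans_def)

section \<open>Explicit commutators above each conjugacy class\<close>

lemma reach_checks:
  "reach_check (word [gen_b, gen_a]) (word [gen_a, gen_a, gen_b]) gen_a (map left chain0 @ map right chain0)"
  "reach_check (word [gen_b, gen_b, gen_a, gen_b, gen_b]) (word [gen_b, gen_a, gen_a, gen_b, gen_a, gen_b]) rep5 (map left chain0 @ map right chain0)"
  "reach_check (word [gen_b]) (word [gen_a]) rep2 (map left chain0 @ map right chain0)"
  "reach_check (word [gen_a]) (word [gen_b, gen_a, gen_a, gen_b, gen_b]) rep4 (map left chain0 @ map right chain0)"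
  by code_simp+

text \<open>No single pair \<open>a\<close>, \<open>b\<close> whose commutator has order 3 reaches every vector. The three
  pairs below reach the hyperplanes \<open>v P0 = 0\<close>, \<open>v P1 = 0\<close> and \<open>v P0 = v P1\<close> (in one of the two
  components), which cover the whole space.\<close>
lemma reach_checks_gen_b:
  "reach_check (word [gen_a, gen_a, gen_a, gen_a, gen_b, gen_a]) (word [gen_a, gen_b, gen_a, gen_b, gen_b, gen_a, gen_a]) gen_b (map left chain1 @ map right chain0)"
  "reach_check (word [gen_a, gen_a, gen_a, gen_a, gen_b, gen_a]) (word [gen_a, gen_a, gen_b, gen_a, gen_a]) gen_b (map left skip1 @ map right chain0)"
  "reach_check (word [gen_a, gen_a, gen_a, gen_a, gen_b, gen_a]) (word [gen_a, gen_b, gen_b, gen_a, gen_b, gen_a, gen_a, gen_a]) gen_b (map left joint @ map right chain0)"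
  by code_simp+

text \<open>The hyperplanes now lie in the second component, the side on which \<open>rep3\<close>
  is a 3-cycle.\<close>

lemma reach_checks_rep3:
  "reach_check (word [gen_a, gen_b, gen_b, gen_a]) (word [gen_a, gen_b, gen_a, gen_a]) rep3 (map left chain0 @ map right chain1)"
  "reach_check (word [gen_a, gen_b, gen_b, gen_a]) (word [gen_a, gen_a, gen_a, gen_b, gen_b, gen_a, gen_b]) rep3 (map left chain0 @ map right skip1)"
  "reach_check (word [gen_a, gen_b, gen_a, gen_b]) (word [gen_b, gen_a, gen_a, gen_b, gen_a, gen_b, gen_b]) rep3 (map left chain0 @ map right joint)"
  by code_simp+

text \<open>Above the identity: an element of order 5 fixing one point on each side reaches all vectors
  avoiding both points, and two four-groups account for the vectors that are full on one side.\<close>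
lemma reach_checks_pone:
  "reach_check (word []) (word [gen_a, gen_b, gen_a, gen_b, gen_b, gen_a, gen_a]) pone (map left chain1 @ map right chain1)"
  "reach_check (word [gen_a, gen_a, gen_a, gen_a, gen_b, gen_a, gen_b, gen_b]) (word [gen_a, gen_b, gen_b, gen_a, gen_b, gen_a, gen_a, gen_a]) pone
     (map left [tone] @ map right chain2)"
  "reach_check (word [gen_a, gen_a, gen_a, gen_a, gen_b, gen_a, gen_b, gen_b]) (word [gen_a, gen_b, gen_a, gen_b, gen_a, gen_a, gen_b, gen_b]) pone
     (map left chain2 @ map right [tone])"
  by code_simp+

lemma Com_reps:
  assumes c: "c \<in> set reps" and v: "ev v"
  shows "Com v c"
proof -
  obtain u u' where u: "v = (u, u')" "\<not> par u" "\<not> par u'"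
    using v by (cases v) auto
  note s = spans_chain0 spans_chain1 spans_joint spans_skip1
  consider "c \<in> {gen_a, rep5, rep2, rep4}" | "c = gen_b" | "c = rep3"
    using c by (auto simp: reps_def)
  then show ?thesis
  proof cases
    case 1
    then show ?thesis
      using reach_checks[THEN spans_Com] u s by (auto simp: word_in_A6)
  next
    case 2
    consider "\<not> app u P0" | "\<not> app u P1" | "app u P0 = app u P1" by blast
    then show ?thesis
      using reach_checks_gen_b[THEN spans_Com] u s 2 by cases (auto simp: word_in_A6)
  next
    case 3
    consider "\<not> app u' P0" | "\<not> app u' P1" | "app u' P0 = app u' P1" by blast
    then show ?thesis
      using reach_checks_rep3[THEN spans_Com] u s 3 by cases (auto simp: word_in_A6)
  qed
qed

lemma Com_nontrivial:
  assumes "c \<in> A6" "c \<noteq> pone" "ev v"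
  shows "Com v c"
proof -
  \<comment> \<open>Conjugating \<open>c\<close> by \<open>k\<close> moves the vector too, so the
    invariant property must speak of all even vectors at once.\<close>
  define Q where "Q c \<longleftrightarrow> (\<forall>v. ev v \<longrightarrow> Com v c)" for c
  have step: "Q (pmul k' (pmul c k))"
    if "Q c" and k: "k \<in> A6" "k' \<in> A6" "pmul k k' = pone" "pmul k' k = pone" for c k k'
    unfolding Q_def
  proof (intro allI impI)
    fix v assume "ev v"
    then have "Com (pmul v k') c"
      using \<open>Q c\<close> k ev_pmul unfolding Q_def by blast
    from Com_conj[OF this k(1-3)] show "Com v (pmul k' (pmul c k))"
      using k by (simp add: pmul_assoc)
  qed
  have "Q c"
    using assms(1,2)
  proof (rule A6_class_induct)
    show "Q c" if "c \<in> set reps" for c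
      using Com_reps that unfolding Q_def by blast
  qed (auto simp: conj_a_def conj_b_def gens_inverse A6_gens intro: step)
  then show ?thesis
    using assms unfolding Q_def by blast
qed

lemma not_tone:
  assumes "u \<noteq> tone"
  obtains i where "\<not> app u i"
  using assms tab_eqI[of u tone] by auto

text \<open>A set missing exactly one of six points has five elements and is odd.\<close>

lemma even_two_zeros:
  assumes "\<not> par u" "u \<noteq> tone"
  obtains i j where "i \<noteq> j" "\<not> app u i" "\<not> app u j"
proof -
  obtain i where i: "\<not> app u i"
    using assms(2) not_tone by blast
  have "\<exists>j. i \<noteq> j \<and> \<not> app u j"
  proof (rule ccontr)
    assume "\<not> ?thesis"
    then have *: "app u j = (j \<noteq> i)" for j using i by metis
    obtain a b c d e f where u: "u = T a b c d e f" by (cases u)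
    have "a = (P0 \<noteq> i)" "b = (P1 \<noteq> i)" "c = (P2 \<noteq> i)" "d = (P3 \<noteq> i)" "e = (P4 \<noteq> i)" "f = (P5 \<noteq> i)"
      using *[of P0] *[of P1] *[of P2] *[of P3] *[of P4] *[of P5] by (simp_all add: u)
    then show False
      using assms(1) u by (cases i) simp_all
  qed
  then show ?thesis using i that by blast
qed

lemma tone_tcomp [simp]: "tcomp tone g = tone"
  by (auto intro: tab_eqI)

text \<open>Above the identity, conjugation moves only the vector. If neither side is full, a
  missing point on each side is moved to \<open>P0\<close>; if one side is full, it stays so, and
  two missing points of the other are moved to \<open>P0\<close> and \<open>P1\<close>.\<close>

lemma Com_pone:
  assumes v: "ev v" "v \<noteq> vone"
  shows "Com v pone"
proof -
  obtain x y where xy: "v = (x, y)" "\<not> par x" "\<not> par y"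
    using v(1) by (cases v) auto
  have par: "\<not> par (tcomp x (fst k))" "\<not> par (tcomp y (snd k))" if "k \<in> A6" for k
    using par_A6[OF that] xy by simp_all
  consider "x \<noteq> tone" "y \<noteq> tone" | "x = tone" "y \<noteq> tone" | "x \<noteq> tone" "y = tone"
    using v xy by (auto simp: vone_def)
  then show ?thesis
  proof cases
    case 1
    obtain i j where "\<not> app x i" "\<not> app y j"
      using 1 not_tone by metis
    moreover obtain k where k: "k \<in> A6" "app (fst k) P0 = i" "app (snd k) P0 = j"
      using A6_transitive(1) by blast
    ultimately have "Com (tcomp x (fst k), tcomp y (snd k)) pone"
      using par[OF k(1)] by (intro spans_Com[OF reach_checks_pone(1)] spans_chain1) (auto simp: word_in_A6)
    then show ?thesis
      using Com_pone_conj[OF _ k(1)] xy by (cases k) simp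
  next
    case 2
    obtain i j where ij: "i \<noteq> j" "\<not> app y i" "\<not> app y j"
      using even_two_zeros xy 2 by metis
    obtain k where k: "k \<in> A6" "app (snd k) P0 = i" "app (snd k) P1 = j"
      using A6_transitive(3)[OF ij(1)] by blast
    then have "Com (tone, tcomp y (snd k)) pone"
      using par[OF k(1)] ij
      by (intro spans_Com[OF reach_checks_pone(2)] spans_chain2 spans_singleton) (auto simp: word_in_A6)
    then show ?thesis
      using Com_pone_conj[OF _ k(1)] xy 2 by (cases k) simp
  next
    case 3
    obtain i j where ij: "i \<noteq> j" "\<not> app x i" "\<not> app x j"
      using even_two_zeros xy 3 by metis
    obtain k where k: "k \<in> A6" "app (fst k) P0 = i" "app (fst k) P1 = j"
      using A6_transitive(2)[OF ij(1)] by blast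
    then have "Com (tcomp x (fst k), tone) pone"
      using par[OF k(1)] ij
      by (intro spans_Com[OF reach_checks_pone(3)] spans_chain2 spans_singleton) (auto simp: word_in_A6)
    then show ?thesis
      using Com_pone_conj[OF _ k(1)] xy 3 by (cases k) simp
  qed
qed

section \<open>The semidirect product as a group\<close>

definition base_group :: "(vec \<times> perm) monoid" where
  "base_group = \<lparr>carrier = {x. ev (fst x) \<and> snd x \<in> A6},
         mult = (\<lambda>x y. (vadd (pmul (fst x) (snd y)) (fst y), pmul (snd x) (snd y))),
         one = (vzero, pone)\<rparr>"

lemma group_base_group: "group base_group"
proof (rule groupI)
  fix x assume "x \<in> carrier base_group"
  then have x: "ev (fst x)" "snd x \<in> A6" by (simp_all add: base_group_def)
  obtain b where b: "b \<in> A6" "pmul b (snd x) = pone" using A6_inverse[OF x(2)] by blast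
  \<comment> \<open>Acting by \<open>snd x\<close> returns \<open>pmul (fst x) b\<close> to
    \<open>fst x\<close>, which cancels against itself in characteristic two.\<close>
  have "(pmul (fst x) b, b) \<in> carrier base_group" "(pmul (fst x) b, b) \<otimes>\<^bsub>base_group\<^esub> x = \<one>\<^bsub>base_group\<^esub>"
    using x b by (simp_all add: base_group_def pmul_assoc)
  then show "\<exists>y\<in>carrier base_group. y \<otimes>\<^bsub>base_group\<^esub> x = \<one>\<^bsub>base_group\<^esub>" by blast
qed (simp_all add: base_group_def A6_mult A6.one pmul_assoc pmul_vadd vadd_assoc)

lemma vadd_eq_iff: "vadd u v = w \<longleftrightarrow> v = vadd u w"
  by (metis vadd_self(2))

lemma is_commutator_base_group:
  assumes "ev v" "c \<in> A6"
  shows "is_commutator base_group (v, c) \<longleftrightarrow> Com v c"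
proof -
  \<comment> \<open>On the left-hand side \<open>v\<close> occurs as a plain summand, so the vector
    equation can be solved for it.\<close>
  have *: "y \<otimes>\<^bsub>base_group\<^esub> (x \<otimes>\<^bsub>base_group\<^esub> (v, c)) = x \<otimes>\<^bsub>base_group\<^esub> y \<longleftrightarrow>
      pmul (snd y) (pmul (snd x) c) = pmul (snd x) (snd y) \<and>
      v = vadd (vadd (pmul (vadd (pmul (fst y) (snd x)) (fst x)) c) (pmul (fst x) (snd y))) (fst y)" for x y
    by (auto simp: base_group_def pmul_vadd pmul_assoc vadd_assoc vadd_eq_iff vadd_left_commute)
  have "(v, c) \<in> carrier base_group"
    using assms by (simp add: base_group_def)
  note ** = is_commutator_iff[OF group_base_group this, unfolded *]
  show ?thesis
  proof
    assume "is_commutator base_group (v, c)"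
    then show "Com v c"
      unfolding ** Com_def reach_def by (auto simp: base_group_def simp del: split_paired_Ex)
  next
    assume "Com v c"
    then obtain a b u w where "a \<in> A6" "b \<in> A6" "ev u" "ev w" "pmul b (pmul a c) = pmul a b"
      "v = vadd (vadd (pmul (vadd (pmul w a) u) c) (pmul u b)) w"
      unfolding Com_def reach_def by blast
    then show "is_commutator base_group (v, c)"
      unfolding ** by (intro bexI[of _ "(u, a)"] bexI[of _ "(w, b)"]) (auto simp: base_group_def)
  qed
qed

lemma noncommutators_base_group: "noncommutators base_group = {(vone, pone)}"
proof -
  have "x = (vone, pone)" if "x \<in> carrier base_group" "\<not> is_commutator base_group x" for x
  proof -
    have "ev (fst x)" "snd x \<in> A6" "\<not> Com (fst x) (snd x)"
      using that is_commutator_base_group[of "fst x" "snd x"] by (simp_all add: base_group_def)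
    then show ?thesis
      using Com_nontrivial Com_pone by (metis prod.collapse)
  qed
  moreover have "ev vone"
    by (simp add: vone_def tone_def)
  moreover from this have "\<not> is_commutator base_group (vone, pone)"
    using is_commutator_base_group not_Com_vone A6.one by blast
  ultimately show ?thesis
    unfolding noncommutators_def using A6.one by (auto simp: base_group_def)
qed

lemma finite_base_group: "finite (carrier base_group)"
proof -
  have "UNIV \<subseteq> (\<lambda>(a, b, c, d, e, f). T a b c d e f) ` (UNIV :: (bool \<times> bool \<times> bool \<times> bool \<times> bool \<times> bool) set)"
  proof
    fix u :: "bool tab"
    show "u \<in> (\<lambda>(a, b, c, d, e, f). T a b c d e f) ` UNIV"
      by (cases u) (force simp: image_iff)
  qed
  then have "finite (UNIV :: bool tab set)"
    by (rule finite_surj [OF finite])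
  then have "finite (UNIV :: vec set)"
    by (simp add: finite_prod)
  then have "finite ((UNIV :: vec set) \<times> A6)"
    using finite_A6 by blast
  moreover have "carrier base_group \<subseteq> UNIV \<times> A6"
    by (auto simp: base_group_def)
  ultimately show ?thesis
    using finite_subset by blast
qed

lemma order_base_group: "2 < order base_group"
proof -
  have "pone \<noteq> gen_a" "vone \<noteq> vzero"
    by (simp_all add: pone_def pts_def gen_a_def vone_def vzero_def tone_def tzero_def)
  then have "card {(vzero, pone), (vone, pone), (vzero, gen_a)} = 3"
    by simp
  moreover have "{(vzero, pone), (vone, pone), (vzero, gen_a)} \<subseteq> carrier base_group"
    using A6.one A6_gens(1) by (simp add: base_group_def vone_def tone_def)
  ultimately show ?thesis
    using card_mono[OF finite_base_group] unfolding order_def by (metis less_eq_Suc_le eval_nat_numeral(2) eval_nat_numeral(3) numeral_3_eq_3 Suc_1)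
qed

lemma one_noncommutator_base_group: "one_noncommutator base_group"
  using group_base_group finite_base_group noncommutators_base_group order_base_group by (simp add: one_noncommutator_def)

theorem mainTheorem2:
  shows "\<exists>\<G> :: nat monoid set. infinite \<G> \<and>
           (\<forall>G\<in>\<G>. group G \<and> finite (carrier G) \<and> (\<exists>!x. x \<in> noncommutators G)) \<and>
           (\<forall>G\<in>\<G>. \<forall>H\<in>\<G>. G \<noteq> H \<longrightarrow> \<not> G \<cong> H)"
  using one_noncommutator_base_group by (rule infinite_family)

end
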